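(* Let $\mathbf{B}=[b_{i,j}]$ be an $n_c\times n_v$ protomatrix (matrix of non-negative integers), let $j\in\{1,\dots,n_v\}$ and let $\ell\ge 0$ be a fixed integer. For an arbitrary but fixed type-$j$ variable node, let $\mathcal{N}_\ell^*(j)$ denote its (random) depth-$\ell$ decoding neighborhood in the lifted Tanner graph of a code drawn uniformly at random from the $(\mathbf{B},\mathbf{h},M,Z,q)$ ensemble. Then $$\Pr\{\mathcal{N}_\ell^*(j)=\mathcal{T}_\ell(j)\}\to 1\qquad\text{as } Z\to\infty,$$ where equality means that $\mathcal{N}_\ell^*(j)$, rooted at the chosen variable node, is isomorphic to the tree $\mathcal{T}_\ell(j)$ as a rooted graph with typed nodes.
   Context: Protograph. A protomatrix $\mathbf{B}=[b_{i,j}]_{1\le i\le n_c,1\le j\le n_v}$ describes a bipartite multigraph (protograph) with one check node (CN) of type $i$ for each row $i$, one variable node (VN) of type $j$ for each column $j$, and $b_{i,j}$ parallel edges, called type-$(i,j)$ edges, between them. Random lifting with lifting factor $Z$. Take $Z$ disjoint copies of the protograph. For each $(i,j)$, independently, the $Zb_{i,j}$ type-$(i,j)$ edges are permuted uniformly at random: each of the $Z$ type-$j$ VNs has $b_{i,j}$ sockets of type $(i,j)$, each of the $Z$ type-$i$ CNs has $b_{i,j}$ sockets of type $(i,j)$, and the $Zb_{i,j}$ VN sockets are matched to the $Zb_{i,j}$ CN sockets by a uniformly random bijection. The result is the lifted Tanner graph, with $Zn_v$ VNs and $Zn_c$ CNs (possibly with parallel edges). Ensemble. A code drawn from the $(\mathbf{B},\mathbf{h},M,Z,q)$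 ensemble has as its Tanner graph a random lifting of $\mathbf{B}$ with factor $Z$. (The remaining parameters are the batch size $M$, the field order $q$, and the rank distribution $\mathbf{h}=(h_0,\dots,h_M)$. They only determine the random coefficients and matrices attached to the edges and CNs, and have no effect on the graph.) Decoding neighborhood. The decoding neighborhood $\mathcal{N}_\ell(j)$ of a VN of type $j$ is the subgraph of the lifted Tanner graph consisting of all nodes reached and all edges traversed by paths of length at most $2\ell$ starting at that VN. Tree $\mathcal{T}_\ell(j)$. Define the component trees: (1) $\tilde{\mathcal{L}}(j)$: root a type-$j$ VN, having $b_{i,j}$ type-$i$ CN children for each $i\in\{1,\dots,n_c\}$. (2) $\mathcal{L}(i,j)$: root a type-$j$ VN with a type-$(i,j)$ incoming edge (edge to its parent), having $b_{i',j}$ type-$i'$ CN children for each $i'\ne i$ and $b_{i,j}-1$ type-$i$ CN children. (3) $\mathcal{R}(i,j)$: root a type-$i$ CN with a type-$(i,j)$ incoming edge, having $b_{i,j'}$ type-$j'$ VN children for each $j'\ne j$ and $b_{i,j}-1$ type-$j$ VN children. $\mathcal{T}_0(j)$ is a single type-$j$ VN (the root). $\mathcal{T}_1(j)$ is obtained by replacing the root by $\tilde{\mathcal{L}}(j)$ and then every type-$i$ leaf CN with a type-$(i,j)$ incoming edge by $\mathcal{R}(i,j)$. For $\ell\ge2$, $\mathcal{T}_\ell(j)$ is obtained from $\mathcal{T}_{\ell-1}(j)$ by replacing every leaf VN of type $j'$ with a type-$(i',j')$ incoming edge by $\mathcal{L}(i',j')$, for all $(i',j')$, and then every leaf CN of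 type $i'$ with a type-$(i',j')$ incoming edge by $\mathcal{R}(i',j')$, for all $(i',j')$. *)

theory Defs
  imports "HOL-Probability.Probability" "HOL-Probability.Product_PMF"
    "HOL-Combinatorics.Permutations"
begin

section \<open>Undirected multigraphs with typed nodes\<close>

text \<open>\<open>VN j\<close> and \<open>CN i\<close> are the types "variable node of type \<open>j\<close>" and "check node of
  type \<open>i\<close>". Edges carry no separate type: an edge between nodes of types \<open>VN j\<close> and
  \<open>CN i\<close> is a type-\<open>(i,j)\<close> edge.\<close>

datatype node_type = VN nat | CN nat

record ('n, 'e) multigraph =
  nodes :: "'n set"
  edges :: "'e set"
  ends :: "'e \<Rightarrow> 'n set"
  ntype :: "'n \<Rightarrow> node_type"

text \<open>Paths are sequences of consecutive edges; repetitions are allowed. In a graph without loops,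
  requiring distinct nodes would give the same neighborhoods: a shortest path from the root to
  whichever end of an edge is nearer to it, followed by that edge, repeats no node.\<close>

inductive is_path :: "('n, 'e) multigraph \<Rightarrow> 'n \<Rightarrow> 'e list \<Rightarrow> 'n \<Rightarrow> bool" for G where
  Nil: "x \<in> nodes G \<Longrightarrow> is_path G x [] x"
| Cons: "e \<in> edges G \<Longrightarrow> ends G e = {x, y} \<Longrightarrow> x \<in> nodes G \<Longrightarrow> is_path G y es z
    \<Longrightarrow> is_path G x (e # es) z"

definition neighborhood :: "('n, 'e) multigraph \<Rightarrow> nat \<Rightarrow> 'n \<Rightarrow> ('n, 'e) multigraph" where
  "neighborhood G d r =
    \<lparr>nodes = {x. \<exists>es. is_path G r es x \<and> length es \<le> d},
     edges = {e. \<exists>es x. is_path G r es x \<and> length es \<le> d \<and> e \<in> set es},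
     ends = ends G,
     ntype = ntype G\<rparr>"

definition rooted_iso ::
  "('n, 'e) multigraph \<Rightarrow> 'n \<Rightarrow> ('m, 'f) multigraph \<Rightarrow> 'm \<Rightarrow> bool" where
  "rooted_iso G r H s \<longleftrightarrow>
    (\<exists>f g. bij_betw f (nodes G) (nodes H) \<and> bij_betw g (edges G) (edges H) \<and>
      (\<forall>e\<in>edges G. ends H (g e) = f ` ends G e) \<and>
      (\<forall>x\<in>nodes G. ntype H (f x) = ntype G x) \<and>
      f r = s)"

section \<open>Random liftings of a protomatrix\<close>

text \<open>A protomatrix is given by its dimensions \<open>nc\<close>, \<open>nv\<close> and its entries \<open>B i j\<close> for
  \<open>i \<in> {1..nc}\<close>, \<open>j \<in> {1..nv}\<close>; other values of \<open>B\<close> are never used.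

  The pair \<open>(k, s)\<close> denotes socket \<open>s\<close> of the \<open>k\<close>-th copy of a node. For each edge type \<open>(i,j)\<close>,
  both the VN sockets and the CN sockets are indexed by \<open>sockets Z (B i j)\<close>, so that a bijection
  from VN sockets to CN sockets is a permutation of this set.\<close>

definition sockets :: "nat \<Rightarrow> nat \<Rightarrow> (nat \<times> nat) set" where
  "sockets Z b = {..<Z} \<times> {..<b}"

type_synonym lifting = "nat \<times> nat \<Rightarrow> nat \<times> nat \<Rightarrow> nat \<times> nat"

text \<open>Law of the socket matchings, one per edge type, independent and uniform. The lifted Tanner
  graph is the only part of the code that is modelled.\<close>

definition random_lifting ::
  "nat \<Rightarrow> nat \<Rightarrow> (nat \<Rightarrow> nat \<Rightarrow> nat) \<Rightarrow> nat \<Rightarrow> lifting pmf" where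
  "random_lifting nc nv B Z =
    Pi_pmf ({1..nc} \<times> {1..nv}) id
      (\<lambda>(i, j). pmf_of_set {\<pi>. \<pi> permutes sockets Z (B i j)})"

text \<open>The node \<open>(t, k)\<close> is the \<open>k\<close>-th copy of the protograph node \<open>t\<close>. An edge \<open>(i, j, k, s)\<close> is
  named by its type \<open>(i, j)\<close> and its VN socket \<open>(k, s)\<close>.\<close>

definition lifted_graph ::
  "nat \<Rightarrow> nat \<Rightarrow> (nat \<Rightarrow> nat \<Rightarrow> nat) \<Rightarrow> nat \<Rightarrow> lifting \<Rightarrow>
    (node_type \<times> nat, nat \<times> nat \<times> nat \<times> nat) multigraph" where
  "lifted_graph nc nv B Z \<sigma> =
    \<lparr>nodes = (VN ` {1..nv} \<union> CN ` {1..nc}) \<times> {..<Z},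
     edges = {(i, j, k, s). i \<in> {1..nc} \<and> j \<in> {1..nv} \<and> (k, s) \<in> sockets Z (B i j)},
     ends = (\<lambda>(i, j, k, s). {(VN j, k), (CN i, fst (\<sigma> (i, j) (k, s)))}),
     ntype = fst\<rparr>"

section \<open>The trees\<close>

datatype ptree = Node (label: node_type) (children: "ptree list")

abbreviation leaf :: "node_type \<Rightarrow> ptree" where
  "leaf t \<equiv> Node t []"

definition Ltilde_tree :: "nat \<Rightarrow> (nat \<Rightarrow> nat \<Rightarrow> nat) \<Rightarrow> nat \<Rightarrow> ptree" where
  "Ltilde_tree nc B j =
    Node (VN j) (concat (map (\<lambda>i. replicate (B i j) (leaf (CN i))) [1..<Suc nc]))"

definition L_tree :: "nat \<Rightarrow> (nat \<Rightarrow> nat \<Rightarrow> nat) \<Rightarrow> nat \<Rightarrow> nat \<Rightarrow> ptree" where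
  "L_tree nc B i j =
    Node (VN j)
      (concat (map (\<lambda>i'. replicate (if i' = i then B i j - 1 else B i' j) (leaf (CN i')))
        [1..<Suc nc]))"

definition R_tree :: "nat \<Rightarrow> (nat \<Rightarrow> nat \<Rightarrow> nat) \<Rightarrow> nat \<Rightarrow> nat \<Rightarrow> ptree" where
  "R_tree nv B i j =
    Node (CN i)
      (concat (map (\<lambda>j'. replicate (if j' = j then B i j - 1 else B i j') (leaf (VN j')))
        [1..<Suc nv]))"

text \<open>\<open>replace_leaves \<rho> t\<close> replaces every leaf of \<open>t\<close> other than the root by \<open>\<rho> u v\<close>, where \<open>v\<close> is
  the type of the leaf and \<open>u\<close> that of its parent; together they determine the type of the incoming
  edge. A lone root is left unchanged, as it has no incoming edge.\<close>

fun replace_leaves :: "(node_type \<Rightarrow> node_type \<Rightarrow> ptree) \<Rightarrow> ptree \<Rightarrow> ptree" where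
  "replace_leaves \<rho> (Node t ts) =
    Node t (map (\<lambda>s. if children s = [] then \<rho> t (label s) else replace_leaves \<rho> s) ts)"

definition replace_VN_leaves :: "nat \<Rightarrow> (nat \<Rightarrow> nat \<Rightarrow> nat) \<Rightarrow> ptree \<Rightarrow> ptree" where
  "replace_VN_leaves nc B =
    replace_leaves (\<lambda>u v. case (u, v) of (CN i, VN j) \<Rightarrow> L_tree nc B i j | _ \<Rightarrow> leaf v)"

definition replace_CN_leaves :: "nat \<Rightarrow> (nat \<Rightarrow> nat \<Rightarrow> nat) \<Rightarrow> ptree \<Rightarrow> ptree" where
  "replace_CN_leaves nv B =
    replace_leaves (\<lambda>u v. case (u, v) of (VN j, CN i) \<Rightarrow> R_tree nv B i j | _ \<Rightarrow> leaf v)"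

fun T_tree :: "nat \<Rightarrow> nat \<Rightarrow> (nat \<Rightarrow> nat \<Rightarrow> nat) \<Rightarrow> nat \<Rightarrow> nat \<Rightarrow> ptree" where
  "T_tree nc nv B 0 j = leaf (VN j)"
| "T_tree nc nv B (Suc 0) j = replace_CN_leaves nv B (Ltilde_tree nc B j)"
| "T_tree nc nv B (Suc (Suc l)) j =
    replace_CN_leaves nv B (replace_VN_leaves nc B (T_tree nc nv B (Suc l) j))"

text \<open>The underlying graph of a tree: a node is named by its position, that is, the list of child
  indices leading to it from the root \<open>[]\<close>, and an edge by the position of its lower end.\<close>

fun subtree :: "ptree \<Rightarrow> nat list \<Rightarrow> ptree option" where
  "subtree t [] = Some t"
| "subtree (Node a ts) (k # p) = (if k < length ts then subtree (ts ! k) p else None)"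

definition tree_graph :: "ptree \<Rightarrow> (nat list, nat list) multigraph" where
  "tree_graph t =
    \<lparr>nodes = {p. subtree t p \<noteq> None},
     edges = {p. subtree t p \<noteq> None \<and> p \<noteq> []},
     ends = (\<lambda>p. {butlast p, p}),
     ntype = (\<lambda>p. label (the (subtree t p)))\<rparr>"

end

theory Submission
  imports Defs
begin

text \<open>The tree \<open>T_tree nc nv B l j\<close> is the universal cover of the protograph truncated at depth
  \<open>2 * l\<close>. It unfolds along non-backtracking walks, so it always maps onto the neighborhood in the
  lifted graph, and the map is an isomorphism as soon as it is injective on nodes. Exploring the tree
  vertex by vertex, the end of the next edge hits one of the boundedly many nodes found so far
  with probability \<open>O(1 / Z)\<close>, by a switching argument.\<close>

text \<open>A matching of sockets gives every copy of a node the degrees of its protograph node, so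
  the shape of the unfolding is deterministic; only the copies that are met are random. All events
  can thus be indexed by tree positions from one finite set that does not depend on
  \<open>Z\<close>, although the walk to a position does depend on the lifting. This is what permits
  a union bound. Conditioning on the part of the graph revealed so far would require the law of a
  uniform permutation given randomly chosen values of it. Counting avoids this: liftings with a
  given collision, each paired with an unvisited copy, are mapped injectively into all liftings, and
  comparing cardinalities bounds the probability.\<close>

locale protomatrix =
  fixes nc nv :: nat and B :: "nat \<Rightarrow> nat \<Rightarrow> nat"
begin

section \<open>The trees as universal covers\<close>

fun nbrs :: "node_type \<Rightarrow> node_type list" where
  "nbrs (VN j) = map CN [1..<Suc nc]"
| "nbrs (CN i) = map VN [1..<Suc nv]"

fun mult :: "node_type \<Rightarrow> node_type \<Rightarrow> nat" where
  "mult (VN j) (CN i) = B i j"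
| "mult (CN i) (VN j) = B i j"
| "mult _ _ = 0"

fun is_VN :: "node_type \<Rightarrow> bool" where
  "is_VN (VN j) = True"
| "is_VN (CN i) = False"

text \<open>Subtracting one uses up the incoming edge when the parent has type \<open>u\<close>. The
  order is that of the component trees, so these turn out to be literally equal to covers of depth
  1, not merely isomorphic.\<close>

definition child_types :: "node_type \<Rightarrow> node_type option \<Rightarrow> node_type list" where
  "child_types t u =
    concat (map (\<lambda>t'. replicate (mult t t' - of_bool (u = Some t')) t') (nbrs t))"

text \<open>The type of the parent is enough memory: sockets between two fixed types have equal
  subtrees behind them, so it only matters that one of them is used up.\<close>

fun cover :: "nat \<Rightarrow> node_type \<Rightarrow> node_type option \<Rightarrow> ptree" where
  "cover 0 t u = leaf t"
| "cover (Suc n) t u = Node t (map (\<lambda>t'. cover n t' (Some t)) (child_types t u))"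

lemma set_child_types: "set (child_types t u) \<subseteq> set (nbrs t)"
  by (auto simp: child_types_def)

lemma is_VN_nbrs: "t' \<in> set (nbrs t) \<Longrightarrow> is_VN t' \<longleftrightarrow> \<not> is_VN t"
  by (cases t) auto

lemma label_cover [simp]: "label (cover n t u) = t"
  by (cases n) auto

text \<open>A vertex without children may occur at any depth; growing the tree leaves it unchanged, so
  only the kind of the vertices at depth \<open>n\<close> matters.\<close>

lemma replace_leaves_cover:
  assumes \<rho>: "\<And>t t'. t' \<in> set (nbrs t) \<Longrightarrow>
      \<rho> t t' = (if is_VN t' = b then cover 1 t' (Some t) else leaf t')"
    and "n > 0" "(is_VN t = b) = even n"
  shows "replace_leaves \<rho> (cover n t u) = cover (Suc n) t u"
  using assms(2,3)
proof (induction n arbitrary: t u)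
  case (Suc n)
  have "(if children (cover n t' (Some t)) = [] then \<rho> t t'
          else replace_leaves \<rho> (cover n t' (Some t))) = cover (Suc n) t' (Some t)"
    if "t' \<in> set (child_types t u)" for t'
  proof -
    have t': "t' \<in> set (nbrs t)"
      using that set_child_types by blast
    note * = \<rho>[OF t'] is_VN_nbrs[OF t']
    show ?thesis
    proof (cases n)
      case 0
      then show ?thesis using * Suc.prems by auto
    next
      case (Suc n')
      then have IH: "replace_leaves \<rho> (cover n t' (Some t)) = cover (Suc n) t' (Some t)"
        using * Suc.prems by (intro Suc.IH) auto
      show ?thesis
      proof (cases "child_types t' (Some t) = []")
        case True
        then show ?thesis using * Suc by auto
      next
        case False
        then have "children (cover n t' (Some t)) \<noteq> []" using Suc by simp
        then show ?thesis using IH by simp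
      qed
    qed
  qed
  then show ?case by (simp cong: if_cong)
qed simp

lemma L_tree_eq_cover: "L_tree nc B i j = cover 1 (VN j) (Some (CN i))"
  by (auto simp: L_tree_def child_types_def map_concat o_def map_replicate
      intro!: arg_cong[where f = concat] map_cong arg_cong2[where f = replicate])

lemma R_tree_eq_cover: "R_tree nv B i j = cover 1 (CN i) (Some (VN j))"
  by (auto simp: R_tree_def child_types_def map_concat o_def map_replicate
      intro!: arg_cong[where f = concat] map_cong arg_cong2[where f = replicate])

lemma Ltilde_tree_eq_cover: "Ltilde_tree nc B j = cover 1 (VN j) None"
  by (auto simp: Ltilde_tree_def child_types_def map_concat o_def map_replicate)

text \<open>Kinds alternate from level to level, so the parity condition says that the vertices at
  depth \<open>n\<close> are VNs.\<close>

lemma replace_VN_leaves_cover: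
  assumes "n > 0" "is_VN t = even n"
  shows "replace_VN_leaves nc B (cover n t u) = cover (Suc n) t u"
  unfolding replace_VN_leaves_def
proof (rule replace_leaves_cover[where b = True])
  fix t t' assume "t' \<in> set (nbrs t)"
  then show "(case (t, t') of (CN i, VN j) \<Rightarrow> L_tree nc B i j | _ \<Rightarrow> leaf t') =
      (if is_VN t' = True then cover 1 t' (Some t) else leaf t')"
    by (cases t; cases t') (auto simp: L_tree_eq_cover simp del: cover.simps)
qed (use assms in auto)

lemma replace_CN_leaves_cover:
  assumes "n > 0" "is_VN t = odd n"
  shows "replace_CN_leaves nv B (cover n t u) = cover (Suc n) t u"
  unfolding replace_CN_leaves_def
proof (rule replace_leaves_cover[where b = False])
  fix t t' assume "t' \<in> set (nbrs t)"
  then show "(case (t, t') of (VN j, CN i) \<Rightarrow> R_tree nv B i j | _ \<Rightarrow> leaf t') =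
      (if is_VN t' = False then cover 1 t' (Some t) else leaf t')"
    by (cases t; cases t') (auto simp: R_tree_eq_cover simp del: cover.simps)
qed (use assms in auto)

lemma T_tree_eq_cover: "T_tree nc nv B l j = cover (2 * l) (VN j) None"
proof (induction l)
  case (Suc l)
  show ?case
  proof (cases l)
    \<comment> \<open>A lone root has no incoming edge to replace along, so the first level comes
      from \<open>Ltilde_tree\<close> instead of a replacement.\<close>
    case 0
    have "cover (2 * Suc 0) (VN j) None = cover (Suc 1) (VN j) None"
      by (simp add: numeral_2_eq_2)
    then show ?thesis
      using 0 by (simp only: T_tree.simps Ltilde_tree_eq_cover) (subst replace_CN_leaves_cover, auto)
  next
    case (Suc l')
    have "cover (2 * Suc l) (VN j) None = cover (Suc (Suc (2 * l))) (VN j) None"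
      by simp
    also have "\<dots> = replace_CN_leaves nv B (cover (Suc (2 * l)) (VN j) None)"
      by (rule replace_CN_leaves_cover[symmetric]) auto
    also have "cover (Suc (2 * l)) (VN j) None = replace_VN_leaves nc B (cover (2 * l) (VN j) None)"
      using Suc by (intro replace_VN_leaves_cover[symmetric]) auto
    finally show ?thesis
      using Suc Suc.IH by simp
  qed
qed simp

section \<open>Darts and non-backtracking walks\<close>

text \<open>The dart \<open>(t, k, t', s)\<close> is socket \<open>s\<close> towards type \<open>t'\<close> of node \<open>(t, k)\<close>, i.e. an edge
  traversed in the direction away from that node.\<close>

type_synonym dart = "node_type \<times> nat \<times> node_type \<times> nat"

definition types :: "node_type set" where
  "types = VN ` {1..nv} \<union> CN ` {1..nc}"

definition darts :: "nat \<Rightarrow> dart set" where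
  "darts Z = {(t, k, t', s). t \<in> types \<and> t' \<in> set (nbrs t) \<and> k < Z \<and> s < mult t t'}"

fun src :: "dart \<Rightarrow> node_type \<times> nat" where
  "src (t, k, t', s) = (t, k)"

fun tgt_type :: "dart \<Rightarrow> node_type" where
  "tgt_type (t, k, t', s) = t'"

text \<open>The same edge seen from its other end: the permutation leads from VN sockets to CN
  sockets and its inverse back, which makes this an involution on the darts of a lifting.\<close>

fun opp :: "lifting \<Rightarrow> dart \<Rightarrow> dart" where
  "opp \<sigma> (VN j, k, CN i, s) = (CN i, fst (\<sigma> (i, j) (k, s)), VN j, snd (\<sigma> (i, j) (k, s)))"
| "opp \<sigma> (CN i, k, VN j, s) =
    (VN j, fst (inv (\<sigma> (i, j)) (k, s)), CN i, snd (inv (\<sigma> (i, j)) (k, s)))"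
| "opp \<sigma> d = d"

text \<open>In use, \<open>a\<close> is the dart at \<open>x\<close> that leads back to the parent,
  and omitting it forbids backtracking. The order agrees with \<open>child_types\<close>, so that
  exits and children share their indices.\<close>

definition outs :: "node_type \<times> nat \<Rightarrow> dart option \<Rightarrow> dart list" where
  "outs x a = filter (\<lambda>d. Some d \<noteq> a)
    (concat (map (\<lambda>t'. map (\<lambda>s. (fst x, snd x, t', s)) [0..<mult (fst x) t']) (nbrs (fst x))))"

text \<open>The second conjunct records the default value of \<open>Pi_pmf\<close> outside the index
  set, so that this is exactly the support of \<open>random_lifting\<close>.\<close>

definition lifts :: "nat \<Rightarrow> lifting set" where
  "lifts Z = {\<sigma>. (\<forall>i\<in>{1..nc}. \<forall>j\<in>{1..nv}. \<sigma> (i, j) permutes sockets Z (B i j)) \<and>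
    (\<forall>ij. ij \<notin> {1..nc} \<times> {1..nv} \<longrightarrow> \<sigma> ij = id)}"

lemma darts_cases:
  assumes "d \<in> darts Z"
  obtains (VN) i j k s where "d = (VN j, k, CN i, s)" "i \<in> {1..nc}" "j \<in> {1..nv}" "k < Z" "s < B i j"
  | (CN) i j k s where "d = (CN i, k, VN j, s)" "i \<in> {1..nc}" "j \<in> {1..nv}" "k < Z" "s < B i j"
  using assms unfolding darts_def types_def by fastforce

lemma lifts_permutes:
  "\<sigma> \<in> lifts Z \<Longrightarrow> i \<in> {1..nc} \<Longrightarrow> j \<in> {1..nv} \<Longrightarrow> \<sigma> (i, j) permutes sockets Z (B i j)"
  by (auto simp: lifts_def)

lemma opp_in_darts:
  assumes "\<sigma> \<in> lifts Z" "d \<in> darts Z"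
  shows "opp \<sigma> d \<in> darts Z"
  using assms(2)
proof (cases rule: darts_cases)
  case (VN i j k s)
  have "\<sigma> (i, j) (k, s) \<in> sockets Z (B i j)"
    using permutes_in_image[OF lifts_permutes[OF assms(1)], of i j "(k, s)"] VN
    by (auto simp: sockets_def)
  then show ?thesis using VN by (auto simp: darts_def types_def sockets_def mem_Times_iff)
next
  case (CN i j k s)
  have "inv (\<sigma> (i, j)) (k, s) \<in> sockets Z (B i j)"
    using permutes_in_image[OF permutes_inv[OF lifts_permutes[OF assms(1)]], of i j "(k, s)"] CN
    by (auto simp: sockets_def)
  then show ?thesis using CN by (auto simp: darts_def types_def sockets_def mem_Times_iff)
qed

lemma opp_opp:
  assumes "\<sigma> \<in> lifts Z" "d \<in> darts Z"
  shows "opp \<sigma> (opp \<sigma> d) = d"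
  using assms(2)
  by (cases rule: darts_cases)
    (auto simp: permutes_inverses[OF lifts_permutes[OF assms(1)]])

lemma tgt_type_eq: "d \<in> darts Z \<Longrightarrow> tgt_type d = fst (src (opp \<sigma> d))"
  and tgt_type_opp: "d \<in> darts Z \<Longrightarrow> tgt_type (opp \<sigma> d) = fst (src d)"
  by (auto elim!: darts_cases)

lemma is_VN_tgt_type: "d \<in> darts Z \<Longrightarrow> is_VN (tgt_type d) \<longleftrightarrow> \<not> is_VN (fst (src d))"
  by (auto elim!: darts_cases)

lemma distinct_nbrs: "distinct (nbrs t)"
  by (cases t) (auto simp: distinct_map inj_on_def)

lemma distinct_outs: "distinct (outs x a)"
proof -
  have "distinct (concat (map (\<lambda>t'. map (\<lambda>s. (t, k, t', s)) [0..<f t']) ts))"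
    if "distinct ts" for ts :: "node_type list" and f and t :: node_type and k :: nat
    using that by (induction ts) (auto simp: distinct_map inj_on_def)
  then show ?thesis
    unfolding outs_def using distinct_nbrs by (intro distinct_filter) blast
qed

lemma set_outs:
  assumes "fst x \<in> types" "snd x < Z"
  shows "set (outs x a) = {d \<in> darts Z. src d = x \<and> Some d \<noteq> a}"
  using assms by (cases x) (auto simp: outs_def darts_def image_iff)

definition valid_state :: "nat \<Rightarrow> (node_type \<times> nat) \<times> dart option \<Rightarrow> bool" where
  "valid_state Z = (\<lambda>(x, a). fst x \<in> types \<and> snd x < Z \<and>
    (\<forall>d. a = Some d \<longrightarrow> d \<in> darts Z \<and> src d = x))"

text \<open>The dart \<open>a\<close> occupies exactly one socket towards its target type; dropping
  it lowers that multiplicity by one, as \<open>of_bool\<close> does in \<open>child_types\<close>.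
  This ties child indices in the tree to sockets in the lifted graph.\<close>

lemma map_tgt_type_outs:
  assumes "valid_state Z (x, a)"
  shows "map tgt_type (outs x a) = child_types (fst x) (map_option tgt_type a)"
proof -
  obtain t k where x: "x = (t, k)" by (cases x)
  have "map tgt_type (filter (\<lambda>d. Some d \<noteq> a) (map (\<lambda>s. (t, k, t', s)) [0..<mult t t'])) =
      replicate (mult t t' - of_bool (map_option tgt_type a = Some t')) t'" (is "?L = ?R")
    for t'
  proof -
    have "?L = replicate (length (filter (\<lambda>s. Some (t, k, t', s) \<noteq> a) [0..<mult t t'])) t'"
      by (simp add: filter_map o_def map_replicate_const)
    also have "length (filter (\<lambda>s. Some (t, k, t', s) \<noteq> a) [0..<mult t t']) =
        card {s. s < mult t t' \<and> Some (t, k, t', s) \<noteq> a}"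
      by (simp add: distinct_length_filter Int_def conj_commute)
    also have "\<dots> = mult t t' - of_bool (map_option tgt_type a = Some t')"
    proof (cases "map_option tgt_type a = Some t'")
      case True
      then obtain s where s: "a = Some (t, k, t', s)" "s < mult t t'"
        using assms x unfolding valid_state_def darts_def by (cases a) force+
      then have "{s. s < mult t t' \<and> Some (t, k, t', s) \<noteq> a} = {..<mult t t'} - {s}"
        by auto
      then show ?thesis using s True by simp
    next
      case False
      then have "{s. s < mult t t' \<and> Some (t, k, t', s) \<noteq> a} = {..<mult t t'}"
        by auto
      then show ?thesis using False by simp
    qed
    finally show ?thesis .
  qed
  then show ?thesis
    unfolding outs_def child_types_def filter_concat map_concat map_map x
    by (simp add: o_def)
qed

section \<open>Tree positions read as walks in the lifted graph\<close>

definition step :: "lifting \<Rightarrow> (node_type \<times> nat) \<times> dart option \<Rightarrow> nat \<Rightarrow>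
    (node_type \<times> nat) \<times> dart option" where
  "step \<sigma> = (\<lambda>(x, a) m. let d = opp \<sigma> (outs x a ! m) in (src d, Some d))"

text \<open>A position serves as instructions for a non-backtracking walk: each index selects an
  exit. The second component is the dart leading back, \<open>None\<close> at the root.\<close>

definition state :: "lifting \<Rightarrow> node_type \<times> nat \<Rightarrow> nat list \<Rightarrow>
    (node_type \<times> nat) \<times> dart option" where
  "state \<sigma> r p = foldl (step \<sigma>) (r, None) p"

abbreviation pos :: "lifting \<Rightarrow> node_type \<times> nat \<Rightarrow> nat list \<Rightarrow> node_type \<times> nat" where
  "pos \<sigma> r p \<equiv> fst (state \<sigma> r p)"

definition exits :: "lifting \<Rightarrow> node_type \<times> nat \<Rightarrow> nat list \<Rightarrow> dart list" where
  "exits \<sigma> r p = outs (pos \<sigma> r p) (snd (state \<sigma> r p))"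

definition positions :: "nat \<Rightarrow> node_type \<Rightarrow> nat list set" where
  "positions n t = {p. subtree (cover n t None) p \<noteq> None}"

lemma state_Nil [simp]: "state \<sigma> r [] = (r, None)"
  by (simp add: state_def)

lemma state_snoc:
  "state \<sigma> r (p @ [m]) = (src (opp \<sigma> (exits \<sigma> r p ! m)), Some (opp \<sigma> (exits \<sigma> r p ! m)))"
  by (simp add: state_def exits_def step_def Let_def split_beta)

lemma subtree_append: "subtree t (p @ q) = Option.bind (subtree t p) (\<lambda>u. subtree u q)"
  by (induction t p rule: subtree.induct) auto

lemma positions_snocD: "p @ [m] \<in> positions n t \<Longrightarrow> p \<in> positions n t"
  by (auto simp: positions_def subtree_append bind_eq_Some_conv)

text \<open>The tree below a position depends on the lifting only through types, so that the set of
  positions and their types do not depend on it at all.\<close>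

lemma subtree_cover:
  assumes \<sigma>: "\<sigma> \<in> lifts Z" and r: "fst r \<in> types" "snd r < Z"
    and "p \<in> positions n (fst r)"
  shows "valid_state Z (state \<sigma> r p) \<and> length p \<le> n \<and>
    subtree (cover n (fst r) None) p =
      Some (cover (n - length p) (fst (pos \<sigma> r p)) (map_option tgt_type (snd (state \<sigma> r p))))"
  using assms(4)
proof (induction p rule: rev_induct)
  case Nil
  then show ?case using r by (auto simp: valid_state_def)
next
  case (snoc m p)
  have "p \<in> positions n (fst r)"
    using snoc.prems by (rule positions_snocD)
  note IH = snoc.IH[OF this]
  obtain x a where xa: "state \<sigma> r p = (x, a)" by (cases "state \<sigma> r p")
  have ne: "subtree (cover (n - length p) (fst x) (map_option tgt_type a)) [m] \<noteq> None"
    using snoc.prems IH xa by (auto simp: positions_def subtree_append)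
  then obtain n' where n': "n - length p = Suc n'"
    by (cases "n - length p") auto
  have *: "map tgt_type (outs x a) = child_types (fst x) (map_option tgt_type a)"
    using map_tgt_type_outs[of Z x a] IH xa by simp
  then have len: "length (child_types (fst x) (map_option tgt_type a)) = length (outs x a)"
    by (metis length_map)
  then have m: "m < length (outs x a)"
    using ne n' by (auto split: if_splits)
  define d where "d = outs x a ! m"
  have "d \<in> set (outs x a)" using m d_def by simp
  then have d: "d \<in> darts Z" "src d = x"
    using set_outs[of x Z a] IH xa by (auto simp: valid_state_def)
  have st: "state \<sigma> r (p @ [m]) = (src (opp \<sigma> d), Some (opp \<sigma> d))"
    by (simp add: state_snoc exits_def xa d_def)
  have "child_types (fst x) (map_option tgt_type a) ! m = tgt_type d"
    using m by (simp flip: * add: d_def)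
  then have "subtree (cover n (fst r) None) (p @ [m]) =
      Some (cover n' (fst (src (opp \<sigma> d))) (Some (tgt_type (opp \<sigma> d))))"
    using IH xa n' m len d by (simp add: subtree_append tgt_type_eq[of d Z \<sigma>] tgt_type_opp)
  moreover have "valid_state Z (state \<sigma> r (p @ [m]))"
    using opp_in_darts[OF \<sigma> d(1)] unfolding st by (auto simp: valid_state_def darts_def)
  moreover have "n' = n - length (p @ [m])" "length (p @ [m]) \<le> n"
    using n' by auto
  ultimately show ?case
    unfolding st by simp
qed

text \<open>In every lifting, a position above depth \<open>n\<close> has as many children as its
  node has exits.\<close>

lemma snoc_in_positions_iff:
  assumes "\<sigma> \<in> lifts Z" "fst r \<in> types" "snd r < Z" "p \<in> positions n (fst r)"
  shows "p @ [m] \<in> positions n (fst r) \<longleftrightarrow> length p < n \<and> m < length (exits \<sigma> r p)"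
proof -
  note * = subtree_cover[OF assms]
  have "map tgt_type (exits \<sigma> r p) =
      child_types (fst (pos \<sigma> r p)) (map_option tgt_type (snd (state \<sigma> r p)))"
    unfolding exits_def by (rule map_tgt_type_outs) (use * in auto)
  then have "length (child_types (fst (pos \<sigma> r p)) (map_option tgt_type (snd (state \<sigma> r p)))) =
      length (exits \<sigma> r p)"
    by (metis length_map)
  then show ?thesis
    using * by (cases "n - length p") (auto simp: positions_def subtree_append)
qed

lemma positions_Nil [simp]: "[] \<in> positions n t"
  by (simp add: positions_def)

lemma exits_nth:
  assumes "\<sigma> \<in> lifts Z" "fst r \<in> types" "snd r < Z" "p @ [m] \<in> positions n (fst r)"
  shows "m < length (exits \<sigma> r p)" "exits \<sigma> r p ! m \<in> darts Z"
    "src (exits \<sigma> r p ! m) = pos \<sigma> r p" "Some (exits \<sigma> r p ! m) \<noteq> snd (state \<sigma> r p)"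
proof -
  have p: "p \<in> positions n (fst r)" using assms(4) by (rule positions_snocD)
  show m: "m < length (exits \<sigma> r p)"
    using snoc_in_positions_iff[OF assms(1-3) p] assms(4) by simp
  have v: "valid_state Z (state \<sigma> r p)" using subtree_cover[OF assms(1-3) p] by simp
  have "exits \<sigma> r p ! m \<in> set (exits \<sigma> r p)" using m by simp
  also have "set (exits \<sigma> r p) = {d \<in> darts Z. src d = pos \<sigma> r p \<and> Some d \<noteq> snd (state \<sigma> r p)}"
    unfolding exits_def using v by (intro set_outs) (auto simp: valid_state_def)
  finally show "exits \<sigma> r p ! m \<in> darts Z" "src (exits \<sigma> r p ! m) = pos \<sigma> r p"
    "Some (exits \<sigma> r p ! m) \<noteq> snd (state \<sigma> r p)" by auto
qed

lemma finite_positions: "finite (positions n t)"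
proof -
  have fin: "finite {p. subtree s p \<noteq> None}" for s
  proof (induction s)
    case (Node t ts)
    have "{p. subtree (Node t ts) p \<noteq> None} =
        insert [] (\<Union>m<length ts. (#) m ` {p. subtree (ts ! m) p \<noteq> None})" (is "?L = ?R")
    proof (intro set_eqI)
      fix p show "p \<in> ?L \<longleftrightarrow> p \<in> ?R" by (cases p) auto
    qed
    then show ?case using Node by simp
  qed
  then show ?thesis unfolding positions_def .
qed

section \<open>Neighborhoods without collisions\<close>

text \<open>Edges are named by their VN sockets, so a dart leaving a CN is pulled back by the
  inverse permutation. The last clause is a dummy for darts between nodes of the same kind.\<close>

fun dart_edge :: "lifting \<Rightarrow> dart \<Rightarrow> nat \<times> nat \<times> nat \<times> nat" where
  "dart_edge \<sigma> (VN j, k, CN i, s) = (i, j, k, s)"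
| "dart_edge \<sigma> (CN i, k, VN j, s) = (i, j, inv (\<sigma> (i, j)) (k, s))"
| "dart_edge \<sigma> d = (0, 0, 0, 0)"

lemma dart_edge_opp:
  assumes "\<sigma> \<in> lifts Z" "d \<in> darts Z"
  shows "dart_edge \<sigma> (opp \<sigma> d) = dart_edge \<sigma> d"
  using assms(2)
  by (cases rule: darts_cases)
    (auto simp: permutes_inverses[OF lifts_permutes[OF assms(1)]])

lemma dart_edge_in_edges:
  assumes "\<sigma> \<in> lifts Z" "d \<in> darts Z"
  shows "dart_edge \<sigma> d \<in> edges (lifted_graph nc nv B Z \<sigma>)"
proof -
  have *: "dart_edge \<sigma> d \<in> edges (lifted_graph nc nv B Z \<sigma>)"
    if "d \<in> darts Z" "is_VN (fst (src d))" for d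
    using that(1) by (cases rule: darts_cases)
      (use that(2) in \<open>auto simp: lifted_graph_def sockets_def\<close>)
  show ?thesis
  proof (cases "is_VN (fst (src d))")
    case False
    then have "is_VN (fst (src (opp \<sigma> d)))"
      using assms(2) is_VN_tgt_type tgt_type_eq by metis
    then show ?thesis
      using *[OF opp_in_darts[OF assms]] dart_edge_opp[OF assms] by simp
  qed (use * assms in blast)
qed

lemma ends_dart_edge:
  assumes "\<sigma> \<in> lifts Z" "d \<in> darts Z"
  shows "ends (lifted_graph nc nv B Z \<sigma>) (dart_edge \<sigma> d) = {src d, src (opp \<sigma> d)}"
  using assms(2)
  by (cases rule: darts_cases)
    (auto simp: lifted_graph_def split_beta permutes_inverses[OF lifts_permutes[OF assms(1)]])

text \<open>Since \<open>ends\<close> is unordered, the dart leaving the VN of the edge may point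
  from \<open>z\<close> to \<open>y\<close>; then its opposite is taken.\<close>

lemma edge_obtain_dart:
  assumes "\<sigma> \<in> lifts Z" "e \<in> edges (lifted_graph nc nv B Z \<sigma>)"
    "ends (lifted_graph nc nv B Z \<sigma>) e = {y, z}"
  obtains d where "d \<in> darts Z" "src d = y" "src (opp \<sigma> d) = z" "dart_edge \<sigma> d = e"
proof -
  obtain i j k s where e: "e = (i, j, k, s)" by (cases e)
  define d where "d = (VN j, k, CN i, s)"
  have d: "d \<in> darts Z" "dart_edge \<sigma> d = e"
    using assms(2) e by (auto simp: d_def darts_def types_def lifted_graph_def sockets_def)
  have "{src d, src (opp \<sigma> d)} = {y, z}"
    using ends_dart_edge[OF assms(1) d(1)] d(2) assms(3) by simp
  then consider "src d = y" "src (opp \<sigma> d) = z" | "src (opp \<sigma> d) = y" "src d = z"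
    by (auto simp: doubleton_eq_iff)
  then show thesis
  proof cases
    case 1
    then show ?thesis using that d by blast
  next
    case 2
    then show ?thesis
      using that[of "opp \<sigma> d"] d opp_in_darts[OF assms(1) d(1)]
        opp_opp[OF assms(1) d(1)] dart_edge_opp[OF assms(1) d(1)] by simp
  qed
qed

lemma src_in_nodes: "d \<in> darts Z \<Longrightarrow> src d \<in> nodes (lifted_graph nc nv B Z \<sigma>)"
  by (auto simp: darts_def types_def lifted_graph_def)

lemma is_path_Nil_iff: "is_path G x [] z \<longleftrightarrow> z = x \<and> x \<in> nodes G"
  by (auto elim: is_path.cases intro: is_path.intros)

lemma is_path_Cons_iff: "is_path G x (e # es) z \<longleftrightarrow>
    (\<exists>y. e \<in> edges G \<and> ends G e = {x, y} \<and> x \<in> nodes G \<and> is_path G y es z)"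
  by (subst is_path.simps) auto

text \<open>Paths are built from the front, whereas positions grow at the far end; this allows the
  two to be extended together.\<close>

lemma is_path_snoc_iff: "is_path G x (es @ [e]) z \<longleftrightarrow>
    (\<exists>y. is_path G x es y \<and> e \<in> edges G \<and> ends G e = {y, z} \<and> z \<in> nodes G)"
proof (induction es arbitrary: x)
  case Nil
  then show ?case by (auto simp: is_path_Nil_iff is_path_Cons_iff)
next
  case (Cons a es)
  then show ?case by (simp add: is_path_Cons_iff) blast
qed

text \<open>The edge by which a position is entered. At the root this is a meaningless
  \<open>the None\<close>, hence the exclusion of \<open>[]\<close> wherever edges are matched with
  positions.\<close>

definition pos_edge :: "lifting \<Rightarrow> node_type \<times> nat \<Rightarrow> nat list \<Rightarrow> nat \<times> nat \<times> nat \<times> nat" where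
  "pos_edge \<sigma> r p = dart_edge \<sigma> (the (snd (state \<sigma> r p)))"

context
  fixes Z n :: nat and \<sigma> :: lifting and r :: "node_type \<times> nat"
  assumes \<sigma>: "\<sigma> \<in> lifts Z" and r: "fst r \<in> types" "snd r < Z"
begin

lemma pos_edge_snoc:
  assumes "p @ [m] \<in> positions n (fst r)"
  shows "pos_edge \<sigma> r (p @ [m]) = dart_edge \<sigma> (exits \<sigma> r p ! m)"
  using exits_nth[OF \<sigma> r assms] dart_edge_opp[OF \<sigma>] by (simp add: pos_edge_def state_snoc)

lemma ends_pos_edge:
  assumes "p @ [m] \<in> positions n (fst r)"
  shows "ends (lifted_graph nc nv B Z \<sigma>) (pos_edge \<sigma> r (p @ [m])) = {pos \<sigma> r p, pos \<sigma> r (p @ [m])}"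
  using exits_nth[OF \<sigma> r assms] ends_dart_edge[OF \<sigma>] pos_edge_snoc[OF assms]
  by (simp add: state_snoc)

lemma path_to_pos:
  assumes "p \<in> positions n (fst r)"
  shows "\<exists>es. is_path (lifted_graph nc nv B Z \<sigma>) r es (pos \<sigma> r p) \<and> length es = length p \<and>
    (p \<noteq> [] \<longrightarrow> pos_edge \<sigma> r p \<in> set es)"
  using assms
proof (induction p rule: rev_induct)
  case Nil
  have "r \<in> nodes (lifted_graph nc nv B Z \<sigma>)"
    using r by (cases r) (auto simp: lifted_graph_def types_def)
  then show ?case by (auto simp: is_path_Nil_iff)
next
  case (snoc m p)
  note d = exits_nth[OF \<sigma> r snoc.prems]
  obtain es where es: "is_path (lifted_graph nc nv B Z \<sigma>) r es (pos \<sigma> r p)" "length es = length p"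
    using snoc.IH[OF positions_snocD[OF snoc.prems]] by blast
  have "is_path (lifted_graph nc nv B Z \<sigma>) r (es @ [pos_edge \<sigma> r (p @ [m])]) (pos \<sigma> r (p @ [m]))"
    using es ends_pos_edge[OF snoc.prems] dart_edge_in_edges[OF \<sigma> d(2)]
      src_in_nodes[OF opp_in_darts[OF \<sigma> d(2)]]
    unfolding is_path_snoc_iff pos_edge_snoc[OF snoc.prems]
    by (intro exI[of _ "pos \<sigma> r p"]) (auto simp: state_snoc)
  then show ?case using es(2) by (intro exI[of _ "es @ [pos_edge \<sigma> r (p @ [m])]"]) simp
qed

text \<open>An edge leaving a position either goes back to the parent or leads to a child.\<close>

lemma pos_of_path:
  assumes "is_path (lifted_graph nc nv B Z \<sigma>) r es x" "length es \<le> n"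
  shows "\<exists>p\<in>positions n (fst r). length p \<le> length es \<and> pos \<sigma> r p = x \<and>
    set es \<subseteq> pos_edge \<sigma> r ` (positions n (fst r) - {[]})"
  using assms
proof (induction es arbitrary: x rule: rev_induct)
  case Nil
  then show ?case by (intro bexI[of _ "[]"]) (auto simp: is_path_Nil_iff)
next
  case (snoc e es)
  from snoc.prems obtain y where y: "is_path (lifted_graph nc nv B Z \<sigma>) r es y"
    "e \<in> edges (lifted_graph nc nv B Z \<sigma>)" "ends (lifted_graph nc nv B Z \<sigma>) e = {y, x}"
    by (auto simp: is_path_snoc_iff)
  obtain p where p: "p \<in> positions n (fst r)" "length p \<le> length es" "pos \<sigma> r p = y"
    and es: "set es \<subseteq> pos_edge \<sigma> r ` (positions n (fst r) - {[]})"
    using snoc.IH[OF y(1)] snoc.prems(2) by auto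
  obtain d where d: "d \<in> darts Z" "src d = y" "src (opp \<sigma> d) = x" "dart_edge \<sigma> d = e"
    using edge_obtain_dart[OF \<sigma> y(2,3)] by blast
  have "\<exists>q. q \<in> positions n (fst r) \<and> length q \<le> length (es @ [e]) \<and> pos \<sigma> r q = x \<and>
      e \<in> pos_edge \<sigma> r ` (positions n (fst r) - {[]})"
  proof (cases "snd (state \<sigma> r p) = Some d")
    case True
    then obtain p' m where pm: "p = p' @ [m]"
      by (cases p rule: rev_cases) auto
    note d' = exits_nth[OF \<sigma> r p(1)[unfolded pm]]
    have "opp \<sigma> (exits \<sigma> r p' ! m) = d"
      using True pm by (simp add: state_snoc)
    then have "src (opp \<sigma> d) = pos \<sigma> r p'"
      using opp_opp[OF \<sigma> d'(2)] d'(3) by simp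
    moreover have "pos_edge \<sigma> r p = e"
      using True d by (simp add: pos_edge_def)
    ultimately show ?thesis
      using d p pm positions_snocD by (intro exI[of _ p']) auto
  next
    case False
    have "valid_state Z (state \<sigma> r p)"
      using subtree_cover[OF \<sigma> r p(1)] by simp
    then have "set (exits \<sigma> r p) = {d \<in> darts Z. src d = y \<and> Some d \<noteq> snd (state \<sigma> r p)}"
      unfolding exits_def p(3) by (intro set_outs) (use p(3) in \<open>auto simp: valid_state_def\<close>)
    then have "d \<in> set (exits \<sigma> r p)"
      using False d by auto
    then obtain m where m: "m < length (exits \<sigma> r p)" "exits \<sigma> r p ! m = d"
      by (auto simp: in_set_conv_nth)
    \<comment> \<open>The bound \<open>length p \<le> length es\<close> carried through the
      induction leaves room for a child within depth \<open>n\<close>.\<close>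
    then have pm: "p @ [m] \<in> positions n (fst r)"
      using snoc_in_positions_iff[OF \<sigma> r p(1)] p(2) snoc.prems(2) by simp
    then show ?thesis
      using pos_edge_snoc[OF pm] m d p(2) by (intro exI[of _ "p @ [m]"]) (auto simp: state_snoc)
  qed
  then show ?case using es by auto
qed

lemma rooted_iso_neighborhood:
  assumes inj: "inj_on (pos \<sigma> r) (positions n (fst r))"
  shows "rooted_iso (neighborhood (lifted_graph nc nv B Z \<sigma>) n r) r
    (tree_graph (cover n (fst r) None)) []"
proof -
  let ?G = "lifted_graph nc nv B Z \<sigma>"
  let ?N = "neighborhood ?G n r"
  let ?P = "positions n (fst r)"
  let ?T = "tree_graph (cover n (fst r) None)"
  have nodes_T: "nodes ?T = ?P" and edges_T: "edges ?T = ?P - {[]}"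
    by (auto simp: tree_graph_def positions_def)
  have len: "length p \<le> n" if "p \<in> ?P" for p
    using subtree_cover[OF \<sigma> r that] by simp
  have ends: "ends ?G (pos_edge \<sigma> r p) = pos \<sigma> r ` {butlast p, p} \<and> butlast p \<in> ?P"
    if "p \<in> ?P - {[]}" for p
    using that ends_pos_edge positions_snocD by (cases p rule: rev_cases) auto
  have nodes: "nodes ?N = pos \<sigma> r ` ?P"
  proof (intro equalityI subsetI)
    fix x assume "x \<in> nodes ?N"
    then obtain es where "is_path ?G r es x" "length es \<le> n"
      by (auto simp: neighborhood_def)
    then show "x \<in> pos \<sigma> r ` ?P"
      using pos_of_path by blast
  next
    fix x assume "x \<in> pos \<sigma> r ` ?P"
    then obtain p where p: "p \<in> ?P" "x = pos \<sigma> r p" by blast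
    then show "x \<in> nodes ?N"
      using path_to_pos[OF p(1)] len[OF p(1)] by (auto simp: neighborhood_def)
  qed
  have edges: "edges ?N = pos_edge \<sigma> r ` (?P - {[]})"
  proof (intro equalityI subsetI)
    fix e assume "e \<in> edges ?N"
    then obtain es x where "is_path ?G r es x" "length es \<le> n" "e \<in> set es"
      by (auto simp: neighborhood_def)
    then show "e \<in> pos_edge \<sigma> r ` (?P - {[]})"
      using pos_of_path by blast
  next
    fix e assume "e \<in> pos_edge \<sigma> r ` (?P - {[]})"
    then obtain p where p: "p \<in> ?P" "p \<noteq> []" "e = pos_edge \<sigma> r p" by blast
    then have "\<exists>es x. is_path ?G r es x \<and> length es \<le> n \<and> e \<in> set es"
      using path_to_pos[OF p(1)] len[OF p(1)] by metis
    then show "e \<in> edges ?N"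
      by (simp add: neighborhood_def)
  qed
  have bij_nodes: "bij_betw (pos \<sigma> r) ?P (nodes ?N)"
    using inj nodes by (simp add: bij_betw_def)
  \<comment> \<open>Equal edges have equal ends, which injectivity on nodes turns into equal pairs
    of a position and its parent. Such a pair determines its lower member, because two positions
    cannot each be the parent of the other. In particular, parallel edges are excluded.\<close>
  have "inj_on (pos_edge \<sigma> r) (?P - {[]})"
  proof (rule inj_onI)
    fix p q assume p: "p \<in> ?P - {[]}" and q: "q \<in> ?P - {[]}" and "pos_edge \<sigma> r p = pos_edge \<sigma> r q"
    then have eq: "pos \<sigma> r ` {butlast p, p} = pos \<sigma> r ` {butlast q, q}"
      using ends by metis
    have sub: "{butlast p, p} \<subseteq> ?P" "{butlast q, q} \<subseteq> ?P"
      using ends[OF p] ends[OF q] p q by auto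
    have "{butlast p, p} = {butlast q, q}"
      by (rule iffD1[OF inj_on_image_eq_iff[OF inj sub] eq])
    then consider "p = q" | "p = butlast q" "q = butlast p"
      by (auto simp: doubleton_eq_iff)
    then show "p = q"
    proof cases
      case 2
      then have "length p < length q" "length q < length p"
        using p q by (metis DiffD2 insertI1 length_butlast diff_less length_greater_0_conv less_numeral_extra(1))+
      then show ?thesis by simp
    qed
  qed
  then have bij_edges: "bij_betw (pos_edge \<sigma> r) (?P - {[]}) (edges ?N)"
    using edges by (simp add: bij_betw_def)
  \<comment> \<open>\<open>rooted_iso\<close> asks for maps from the neighborhood to the tree,
    opposite in direction to \<open>pos\<close> and \<open>pos_edge\<close>.\<close>
  define f where "f = inv_into ?P (pos \<sigma> r)"
  define g where "g = inv_into (?P - {[]}) (pos_edge \<sigma> r)"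
  have f: "f (pos \<sigma> r p) = p" if "p \<in> ?P" for p
    unfolding f_def using inj that by (rule inv_into_f_f)
  show ?thesis
    unfolding rooted_iso_def
  proof (intro exI conjI ballI)
    show "bij_betw f (nodes ?N) (nodes ?T)"
      unfolding f_def nodes_T using bij_nodes by (rule bij_betw_inv_into)
    show "bij_betw g (edges ?N) (edges ?T)"
      unfolding g_def edges_T using bij_edges by (rule bij_betw_inv_into)
    show "ends ?T (g e) = f ` ends ?N e" if e: "e \<in> edges ?N" for e
    proof -
      have g: "g e \<in> ?P - {[]}" "pos_edge \<sigma> r (g e) = e"
        using e bij_edges unfolding g_def
        by (metis bij_betw_imp_surj_on inv_into_into, metis bij_betw_inv_into_right)
      then have "ends ?N e = pos \<sigma> r ` {butlast (g e), g e}"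
        using ends[OF g(1)] by (simp add: neighborhood_def)
      moreover have "f ` pos \<sigma> r ` {butlast (g e), g e} = {butlast (g e), g e}"
        using g ends[OF g(1)] f by simp
      ultimately show ?thesis by (simp add: tree_graph_def)
    qed
    show "ntype ?T (f x) = ntype ?N x" if x: "x \<in> nodes ?N" for x
    proof -
      obtain p where p: "p \<in> ?P" "x = pos \<sigma> r p" using x nodes by auto
      then show ?thesis
        using subtree_cover[OF \<sigma> r p(1)] f
        by (simp add: tree_graph_def neighborhood_def lifted_graph_def)
    qed
    show "f r = []"
      using f[of "[]"] by simp
  qed
qed

end

section \<open>Collisions are rare\<close>

text \<open>The two darts exchange their partners. VN sockets are arguments of the permutation and
  CN sockets its values, hence composition on the right or on the left. The types in the second dart
  are ignored because it is always a relocation of the first.\<close>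

fun switch :: "dart \<Rightarrow> dart \<Rightarrow> lifting \<Rightarrow> lifting" where
  "switch (VN j, k, CN i, s) (_, k', _, s') \<sigma> =
    \<sigma>((i, j) := \<sigma> (i, j) \<circ> Transposition.transpose (k, s) (k', s'))"
| "switch (CN i, k, VN j, s) (_, k', _, s') \<sigma> =
    \<sigma>((i, j) := Transposition.transpose (k, s) (k', s') \<circ> \<sigma> (i, j))"
| "switch _ _ \<sigma> = \<sigma>"

fun relocate :: "nat \<Rightarrow> dart \<Rightarrow> dart" where
  "relocate x (t, k, t', s) = (t, x, t', s)"

lemma src_relocate: "src (relocate x d) = (fst (src d), x)"
  by (cases d) auto

text \<open>Relocation keeps the socket number and loses only the original copy, which
  \<open>src\<close> supplies. This is what later makes rewiring reversible.\<close>

lemma relocate_eqD: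
  "relocate x d = relocate y e \<Longrightarrow> src d = src e \<Longrightarrow> x = y \<and> d = e"
  by (cases d; cases e) auto

lemma switch_in_lifts:
  assumes "\<sigma> \<in> lifts Z" "d \<in> darts Z" "x < Z"
  shows "switch d (relocate x d) \<sigma> \<in> lifts Z"
  using assms(2)
proof (cases rule: darts_cases)
  case (VN i j k s)
  have "\<sigma> (i, j) \<circ> Transposition.transpose (k, s) (x, s) permutes sockets Z (B i j)"
    using VN assms by (intro permutes_compose permutes_swap_id lifts_permutes) (auto simp: sockets_def)
  then show ?thesis using VN assms(1) by (auto simp: lifts_def)
next
  case (CN i j k s)
  have "Transposition.transpose (k, s) (x, s) \<circ> \<sigma> (i, j) permutes sockets Z (B i j)"
    using CN assms by (intro permutes_compose permutes_swap_id lifts_permutes) (auto simp: sockets_def)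
  then show ?thesis using CN assms(1) by (auto simp: lifts_def)
qed

lemma switch_switch:
  "d \<in> darts Z \<Longrightarrow> switch d (relocate x d) (switch d (relocate x d) \<sigma>) = \<sigma>"
  \<comment> \<open>The two transpositions meet to the right of the permutation for a VN dart and to
    the left for a CN dart, so the cases need opposite bracketings.\<close>
  by (erule darts_cases) (auto simp: o_assoc[symmetric], auto simp: o_assoc)

lemma transpose_dart:
  "Transposition.transpose (t, k, t', s) (t, x, t', s) (u, y, u', z) =
    (if u = t \<and> u' = t' then
       (t, fst (Transposition.transpose (k, s) (x, s) (y, z)), t',
        snd (Transposition.transpose (k, s) (x, s) (y, z)))
     else (u, y, u', z))"
  by (simp add: Transposition.transpose_def)

text \<open>Exchanging two sockets amounts to renaming two darts, so the pairing is conjugated by a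
  transposition. Hence \<open>opp\<close> can change only at these two darts and at their former
  partners.\<close>

lemma opp_switch:
  assumes "\<sigma> \<in> lifts Z" "d \<in> darts Z" "e \<in> darts Z"
  shows "opp (switch d (relocate x d) \<sigma>) e =
    Transposition.transpose d (relocate x d) (opp \<sigma> (Transposition.transpose d (relocate x d) e))"
  using assms(2)
proof (cases rule: darts_cases)
  case VN: (VN i j k s)
  note bij = permutes_bij[OF lifts_permutes[OF assms(1) VN(2,3)]]
  have inv: "inv (\<sigma> (i, j) \<circ> Transposition.transpose (k, s) (x, s)) =
      Transposition.transpose (k, s) (x, s) \<circ> inv (\<sigma> (i, j))"
    by (subst o_inv_distrib) (auto simp: bij)
  show ?thesis
    using assms(3) by (cases rule: darts_cases)
      (simp_all add: VN(1) inv transpose_dart)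
next
  case CN: (CN i j k s)
  note bij = permutes_bij[OF lifts_permutes[OF assms(1) CN(2,3)]]
  have inv: "inv (Transposition.transpose (k, s) (x, s) \<circ> \<sigma> (i, j)) =
      inv (\<sigma> (i, j)) \<circ> Transposition.transpose (k, s) (x, s)"
    by (subst o_inv_distrib) (auto simp: bij)
  show ?thesis
    using assms(3) by (cases rule: darts_cases)
      (simp_all add: CN(1) inv transpose_dart)
qed

text \<open>Independent uniform matchings are jointly uniform on the product set, which turns
  probabilities into ratios of cardinalities.\<close>

lemma finite_lifts: "finite (lifts Z)"
  and lifts_nonempty: "lifts Z \<noteq> {}"
  and random_lifting_eq: "random_lifting nc nv B Z = pmf_of_set (lifts Z)"
proof -
  let ?I = "{1..nc} \<times> {1..nv}"
  let ?A = "\<lambda>(i, j). {\<pi>. \<pi> permutes sockets Z (B i j)}"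
  have lifts: "lifts Z = PiE_dflt ?I id ?A"
    by (auto simp: lifts_def PiE_dflt_def)
  have fin: "finite (?A ij)" for ij
    by (auto simp: sockets_def intro!: finite_permutations split: prod.splits)
  then show "finite (lifts Z)"
    unfolding lifts by (intro finite_PiE_dflt) auto
  have id: "id \<in> ?A ij" for ij
    by (auto simp: permutes_id)
  then have "(\<lambda>_. id) \<in> lifts Z"
    unfolding lifts PiE_dflt_def by auto
  then show "lifts Z \<noteq> {}" by blast
  have "random_lifting nc nv B Z = Pi_pmf ?I id (\<lambda>ij. pmf_of_set (?A ij))"
    unfolding random_lifting_def by (intro arg_cong[where f = "Pi_pmf ?I id"]) auto
  also have "\<dots> = pmf_of_set (PiE_dflt ?I id ?A)"
    using fin id by (intro Pi_pmf_of_set) blast+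
  finally show "random_lifting nc nv B Z = pmf_of_set (lifts Z)"
    unfolding lifts .
qed

text \<open>Let \<open>p\<close> be the next vertex to be explored after \<open>S\<close>. If it collides with \<open>q\<close>, then rewiring
  the edge leading to it towards a copy \<open>x\<close> not visited so far does not affect the exploration
  of \<open>S\<close>, and can be undone as the original end of the edge is the node at \<open>q\<close>. So each lifting
  with a collision gives rise to at least \<open>Z - card S\<close> liftings, without repetition.\<close>

lemma card_collision_le:
  assumes r: "fst r \<in> types" "snd r < Z"
    and p: "p @ [m] \<in> positions n (fst r)" "p @ [m] \<notin> S" "p \<in> S"
    and S: "S \<subseteq> positions n (fst r)" "\<And>q m. q @ [m] \<in> S \<Longrightarrow> q \<in> S" and q: "q \<in> S"
  defines "C \<equiv> {\<sigma> \<in> lifts Z. inj_on (pos \<sigma> r) S \<and> pos \<sigma> r (p @ [m]) = pos \<sigma> r q}"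
  shows "card C * (Z - card S) \<le> card (lifts Z)"
proof -
  have finS: "finite S"
    using S(1) finite_positions finite_subset by blast
  have finC: "finite C"
    using finite_lifts unfolding C_def by simp
  define d where "d = (\<lambda>\<sigma>. exits \<sigma> r p ! m)"
  define fresh where "fresh = (\<lambda>\<sigma>. {x. x < Z \<and> (fst (pos \<sigma> r (p @ [m])), x) \<notin> pos \<sigma> r ` S})"
  define rewire where
    "rewire = (\<lambda>(\<sigma>, x). switch (opp \<sigma> (d \<sigma>)) (relocate x (opp \<sigma> (d \<sigma>))) \<sigma>)"
  \<comment> \<open>Each position in \<open>S\<close> rules out at most one copy of the given
    type.\<close>
  have card_fresh: "Z - card S \<le> card (fresh \<sigma>)" for \<sigma>
  proof -
    have "card (Pair (fst (pos \<sigma> r (p @ [m]))) ` ({..<Z} - fresh \<sigma>)) \<le> card (pos \<sigma> r ` S)"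
      using finS by (intro card_mono) (auto simp: fresh_def)
    also have "\<dots> \<le> card S"
      using finS by (rule card_image_le)
    finally have "card ({..<Z} - fresh \<sigma>) \<le> card S"
      by (subst (asm) card_image) (auto simp: inj_on_def)
    moreover have "card ({..<Z} - fresh \<sigma>) = Z - card (fresh \<sigma>)"
      by (subst card_Diff_subset) (auto simp: fresh_def)
    ultimately show ?thesis by simp
  qed
  have main: "rewire (\<sigma>, x) \<in> lifts Z" "opp \<sigma> (d \<sigma>) \<in> darts Z"
    "src (opp \<sigma> (d \<sigma>)) = pos \<sigma> r q"
    "opp (rewire (\<sigma>, x)) (d \<sigma>) = relocate x (opp \<sigma> (d \<sigma>))"
    "\<forall>p'\<in>S. state (rewire (\<sigma>, x)) r p' = state \<sigma> r p'"
    if "\<sigma> \<in> C" "x \<in> fresh \<sigma>" for \<sigma> x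
  proof -
    from that(1) have \<sigma>: "\<sigma> \<in> lifts Z" and inj: "inj_on (pos \<sigma> r) S"
      and coll: "pos \<sigma> r (p @ [m]) = pos \<sigma> r q"
      by (auto simp: C_def)
    from that(2) have x: "x < Z" and x_fresh: "(fst (pos \<sigma> r (p @ [m])), x) \<notin> pos \<sigma> r ` S"
      by (auto simp: fresh_def)
    have d_\<sigma>: "exits \<sigma> r p ! m = d \<sigma>"
      by (simp add: d_def)
    note ex = exits_nth[OF \<sigma> r p(1), unfolded d_\<sigma>]
    show od: "opp \<sigma> (d \<sigma>) \<in> darts Z"
      using opp_in_darts[OF \<sigma> ex(2)] .
    have pos_pm: "pos \<sigma> r (p @ [m]) = src (opp \<sigma> (d \<sigma>))"
      by (simp add: state_snoc d_def)
    then show "src (opp \<sigma> (d \<sigma>)) = pos \<sigma> r q"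
      using coll by simp
    define y where "y = relocate x (opp \<sigma> (d \<sigma>))"
    have src_y: "src y \<notin> pos \<sigma> r ` S"
      using x_fresh pos_pm by (simp add: y_def src_relocate)
    show "rewire (\<sigma>, x) \<in> lifts Z"
      unfolding rewire_def using switch_in_lifts[OF \<sigma> od x] by simp
    have opp_rewire: "opp (rewire (\<sigma>, x)) e =
        Transposition.transpose (opp \<sigma> (d \<sigma>)) y
          (opp \<sigma> (Transposition.transpose (opp \<sigma> (d \<sigma>)) y e))" if "e \<in> darts Z" for e
      unfolding rewire_def y_def using opp_switch[OF \<sigma> od that] by simp
    \<comment> \<open>The two darts of an edge leave nodes of different kinds.\<close>
    have "d \<sigma> \<noteq> opp \<sigma> (d \<sigma>)"
      using is_VN_tgt_type[OF ex(2)] tgt_type_opp[OF ex(2)] by metis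
    moreover have "d \<sigma> \<noteq> y"
      using src_y ex(3) p(3) by auto
    ultimately show "opp (rewire (\<sigma>, x)) (d \<sigma>) = relocate x (opp \<sigma> (d \<sigma>))"
      using opp_rewire[OF ex(2)] by (simp add: y_def)
    \<comment> \<open>It suffices that no walk to a position in \<open>S\<close> uses a dart at
      which \<open>opp\<close> changes. The dart \<open>y\<close> and its partner are excluded by
      freshness of \<open>x\<close>, the rewired edge by injectivity on \<open>S\<close>: each of
      its directions would have to be used at or next to \<open>p\<close> itself.\<close>
    show "\<forall>p'\<in>S. state (rewire (\<sigma>, x)) r p' = state \<sigma> r p'"
    proof
      fix p' assume "p' \<in> S"
      then show "state (rewire (\<sigma>, x)) r p' = state \<sigma> r p'"
      proof (induction p' rule: rev_induct)
        case (snoc m' p')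
        then have p': "p' \<in> S" and IH: "state (rewire (\<sigma>, x)) r p' = state \<sigma> r p'"
          using S(2) by blast+
        define e where "e = exits \<sigma> r p' ! m'"
        have "p' @ [m'] \<in> positions n (fst r)" using snoc.prems S(1) by blast
        note ex' = exits_nth[OF \<sigma> r this, folded e_def]
        have pos_e: "pos \<sigma> r (p' @ [m']) = src (opp \<sigma> e)"
          by (simp add: state_snoc e_def)
        have "e \<noteq> d \<sigma>"
        proof
          assume eq: "e = d \<sigma>"
          then have "pos \<sigma> r p' = pos \<sigma> r p" using ex ex' by simp
          then have "p' = p" using inj p' p(3) by (auto dest: inj_onD)
          moreover have "m' = m"
            using eq ex(1) ex'(1) distinct_outs \<open>p' = p\<close>
            unfolding e_def d_def exits_def by (simp add: nth_eq_iff_index_eq)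
          ultimately show False using snoc.prems p(2) by simp
        qed
        \<comment> \<open>Otherwise \<open>p\<close> would be entered through the rewired edge, and
          leaving it by \<open>d \<sigma>\<close> would be backtracking.\<close>
        moreover have "e \<noteq> opp \<sigma> (d \<sigma>)"
        proof
          assume eq: "e = opp \<sigma> (d \<sigma>)"
          then have oe: "opp \<sigma> e = d \<sigma>" using opp_opp[OF \<sigma> ex(2)] by simp
          then have "pos \<sigma> r (p' @ [m']) = pos \<sigma> r p" using pos_e ex(3) by simp
          then have "p' @ [m'] = p" using inj snoc.prems p(3) by (auto dest: inj_onD)
          then have "snd (state \<sigma> r p) = Some (d \<sigma>)"
            using oe by (auto simp: state_snoc e_def)
          then show False using ex(4) by simp
        qed
        moreover have "e \<noteq> y"
          using src_y ex'(3) p' by auto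
        moreover have "opp \<sigma> e \<noteq> y"
          using src_y pos_e snoc.prems by (metis imageI)
        moreover have "opp \<sigma> e \<noteq> opp \<sigma> (d \<sigma>)"
          using \<open>e \<noteq> d \<sigma>\<close> opp_opp[OF \<sigma> ex(2)] opp_opp[OF \<sigma> ex'(2)] by metis
        ultimately have "opp (rewire (\<sigma>, x)) e = opp \<sigma> e"
          using opp_rewire[OF ex'(2)] by simp
        then show ?case
          using IH by (simp add: state_snoc exits_def e_def)
      qed simp
    qed
  qed
  have "inj_on rewire (Sigma C fresh)"
  proof (rule inj_onI, clarify)
    fix \<sigma>1 x1 \<sigma>2 x2
    assume 1: "\<sigma>1 \<in> C" "x1 \<in> fresh \<sigma>1" and 2: "\<sigma>2 \<in> C" "x2 \<in> fresh \<sigma>2"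
      and eq: "rewire (\<sigma>1, x1) = rewire (\<sigma>2, x2)"
    have st: "state \<sigma>1 r p' = state \<sigma>2 r p'" if "p' \<in> S" for p'
      using main(5)[OF 1] main(5)[OF 2] eq that by simp
    then have d: "d \<sigma>1 = d \<sigma>2"
      using p(3) by (simp add: d_def exits_def)
    \<comment> \<open>The rewired lifting reveals the exit dart and its new partner, hence
      \<open>x\<close> and the socket number. The lost copy number is that of the node at
      \<open>q\<close>, which is also visible; this is why the collision is with one fixed
      \<open>q\<close>.\<close>
    have "relocate x1 (opp \<sigma>1 (d \<sigma>1)) = relocate x2 (opp \<sigma>2 (d \<sigma>2))"
      using main(4)[OF 1] main(4)[OF 2] eq d by simp
    moreover have "src (opp \<sigma>1 (d \<sigma>1)) = src (opp \<sigma>2 (d \<sigma>2))"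
      using main(3)[OF 1] main(3)[OF 2] st[OF q] by simp
    ultimately have x: "x1 = x2" and od: "opp \<sigma>1 (d \<sigma>1) = opp \<sigma>2 (d \<sigma>2)"
      using relocate_eqD by blast+
    have "\<sigma>1 = switch (opp \<sigma>1 (d \<sigma>1)) (relocate x1 (opp \<sigma>1 (d \<sigma>1))) (rewire (\<sigma>1, x1))"
      using switch_switch[OF main(2)[OF 1]] by (simp add: rewire_def)
    also have "\<dots> = switch (opp \<sigma>2 (d \<sigma>2)) (relocate x2 (opp \<sigma>2 (d \<sigma>2))) (rewire (\<sigma>2, x2))"
      by (simp only: od x eq[unfolded x])
    also have "\<dots> = \<sigma>2"
      using switch_switch[OF main(2)[OF 2]] by (simp add: rewire_def)
    finally show "\<sigma>1 = \<sigma>2 \<and> x1 = x2" using x by simp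
  qed
  then have "card (Sigma C fresh) \<le> card (lifts Z)"
    using main(1) by (intro card_inj_on_le[of rewire]) (auto simp: finite_lifts)
  moreover have "card (Sigma C fresh) = (\<Sum>\<sigma>\<in>C. card (fresh \<sigma>))"
    using finC by (subst card_SigmaI) (auto simp: fresh_def)
  moreover have "card C * (Z - card S) \<le> (\<Sum>\<sigma>\<in>C. card (fresh \<sigma>))"
    using sum_mono[of C "\<lambda>_. Z - card S" "\<lambda>\<sigma>. card (fresh \<sigma>)"] card_fresh by simp
  ultimately show ?thesis by linarith
qed

section \<open>From counting liftings to the limit\<close>

lemma prob_collision_le:
  assumes r: "fst r \<in> types" "snd r < Z"
    and p: "p @ [m] \<in> positions n (fst r)" "p @ [m] \<notin> S" "p \<in> S"
    and S: "S \<subseteq> positions n (fst r)" "\<And>q m. q @ [m] \<in> S \<Longrightarrow> q \<in> S" and q: "q \<in> S"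
    and Z: "card S < Z"
  shows "measure_pmf.prob (random_lifting nc nv B Z)
    {\<sigma>. inj_on (pos \<sigma> r) S \<and> pos \<sigma> r (p @ [m]) = pos \<sigma> r q} \<le> 1 / (real Z - real (card S))"
proof -
  let ?C = "{\<sigma> \<in> lifts Z. inj_on (pos \<sigma> r) S \<and> pos \<sigma> r (p @ [m]) = pos \<sigma> r q}"
  have "real (card ?C * (Z - card S)) \<le> real (card (lifts Z))"
    using card_collision_le[OF r p S q] by (rule of_nat_mono)
  then have "real (card ?C) * (real Z - real (card S)) \<le> real (card (lifts Z))"
    using Z by (simp add: of_nat_diff)
  moreover have "0 < card (lifts Z)"
    using finite_lifts lifts_nonempty by (simp add: card_gt_0_iff)
  ultimately have "real (card ?C) / card (lifts Z) \<le> 1 / (real Z - real (card S))"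
    using Z by (simp add: field_simps)
  moreover have "measure_pmf.prob (random_lifting nc nv B Z)
      {\<sigma>. inj_on (pos \<sigma> r) S \<and> pos \<sigma> r (p @ [m]) = pos \<sigma> r q} = card ?C / card (lifts Z)"
    unfolding random_lifting_eq
    by (subst measure_pmf_of_set[OF lifts_nonempty finite_lifts]) (simp add: Int_def)
  ultimately show ?thesis by simp
qed

text \<open>Induction over prefix-closed sets, removing a position of maximal length: it is a proper
  prefix of no other, so the rest stays prefix-closed and contains its parent. A failure of
  injectivity either occurs in the rest \<open>S'\<close> or is a collision with one of its
  \<open>card S'\<close> members, and \<open>card S' / (Z - card S')\<close> vanishes because
  \<open>S'\<close> is fixed.\<close>

lemma prob_not_inj_tendsto_0:
  assumes r: "\<And>Z. Z > 0 \<Longrightarrow> fst (r Z) = t \<and> snd (r Z) < Z" "t \<in> types"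
    and S: "S \<subseteq> positions n t" "\<And>q m. q @ [m] \<in> S \<Longrightarrow> q \<in> S"
  shows "(\<lambda>Z. measure_pmf.prob (random_lifting nc nv B Z) {\<sigma>. \<not> inj_on (pos \<sigma> (r Z)) S})
    \<longlonglongrightarrow> 0"
  using S
proof (induction "card S" arbitrary: S rule: less_induct)
  case less
  note S = less.prems
  have finS: "finite S"
    using S(1) finite_positions finite_subset by blast
  show ?case
  proof (cases "S \<subseteq> {[]}")
    case True
    then have "inj_on f S" for f :: "nat list \<Rightarrow> node_type \<times> nat"
      by (auto simp: inj_on_def)
    then show ?thesis by simp
  next
    case False
    then have "S \<noteq> {}" by auto
    then have "Max (length ` S) \<in> length ` S"
      using finS by (intro Max_in) auto
    then obtain p' where "p' \<in> S" "length p' = Max (length ` S)"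
      by force
    then have p': "p' \<in> S" "\<And>q. q \<in> S \<Longrightarrow> length q \<le> length p'"
      using finS by auto
    have "p' \<noteq> []" using False p'(2) by force
    then obtain p m where pm: "p' = p @ [m]" by (cases p' rule: rev_cases) auto
    define S' where "S' = S - {p @ [m]}"
    have S': "S' \<subseteq> positions n t" "S = insert (p @ [m]) S'" "p @ [m] \<notin> S'" "p \<in> S'"
      using S p' pm by (auto simp: S'_def)
    have S'_closed: "q \<in> S'" if "q @ [m'] \<in> S'" for q m'
      using that S(2) p'(2)[of "q @ [m']"] pm by (auto simp: S'_def)
    have finS': "finite S'" using finS by (simp add: S'_def)
    have pos: "p @ [m] \<in> positions n t" using S p' pm by auto
    define P where "P = (\<lambda>Z A. measure_pmf.prob (random_lifting nc nv B Z) A)"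
    have "card S' < card S" using finS' S' by simp
    then have lim: "(\<lambda>Z. P Z {\<sigma>. \<not> inj_on (pos \<sigma> (r Z)) S'}) \<longlonglongrightarrow> 0"
      unfolding P_def using S'(1) S'_closed by (rule less.hyps)
    have bound: "P Z {\<sigma>. \<not> inj_on (pos \<sigma> (r Z)) S} \<le>
        P Z {\<sigma>. \<not> inj_on (pos \<sigma> (r Z)) S'} + card S' * (1 / (real Z - real (card S')))"
      if Z: "card S' < Z" for Z
    proof -
      define E where "E = (\<lambda>q. {\<sigma>. inj_on (pos \<sigma> (r Z)) S' \<and> pos \<sigma> (r Z) (p @ [m]) = pos \<sigma> (r Z) q})"
      have rZ: "fst (r Z) = t" "snd (r Z) < Z" using r(1)[of Z] Z by auto
      have "{\<sigma>. \<not> inj_on (pos \<sigma> (r Z)) S} \<subseteq> {\<sigma>. \<not> inj_on (pos \<sigma> (r Z)) S'} \<union> (\<Union>q\<in>S'. E q)"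
        using S'(3) by (auto simp: S'(2) E_def)
      then have "P Z {\<sigma>. \<not> inj_on (pos \<sigma> (r Z)) S} \<le>
          P Z ({\<sigma>. \<not> inj_on (pos \<sigma> (r Z)) S'} \<union> (\<Union>q\<in>S'. E q))"
        unfolding P_def by (intro measure_pmf.finite_measure_mono) auto
      also have "\<dots> \<le> P Z {\<sigma>. \<not> inj_on (pos \<sigma> (r Z)) S'} + P Z (\<Union>q\<in>S'. E q)"
        unfolding P_def by (intro measure_Un_le) auto
      also have "P Z (\<Union>q\<in>S'. E q) \<le> (\<Sum>q\<in>S'. P Z (E q))"
        unfolding P_def using finS'
        by (intro measure_UNION_le) auto
      also have "\<dots> \<le> (\<Sum>q\<in>S'. 1 / (real Z - real (card S')))"
        unfolding P_def E_def using rZ r(2) pos S' S'_closed Z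
        by (intro sum_mono prob_collision_le[where n = n]) auto
      finally show ?thesis by simp
    qed
    have "filterlim (\<lambda>Z. - real (card S') + real Z) at_top sequentially"
      by (rule filterlim_tendsto_add_at_top[OF tendsto_const filterlim_real_sequentially])
    then have "(\<lambda>Z. card S' * (1 / (real Z - real (card S')))) \<longlonglongrightarrow> real (card S') * 0"
      by (intro tendsto_mult tendsto_const tendsto_divide_0[OF tendsto_const]
          filterlim_at_top_imp_at_infinity) simp
    from tendsto_add[OF lim this]
    have "(\<lambda>Z. P Z {\<sigma>. \<not> inj_on (pos \<sigma> (r Z)) S'} + card S' * (1 / (real Z - real (card S'))))
        \<longlonglongrightarrow> 0"
      by simp
    then have "(\<lambda>Z. P Z {\<sigma>. \<not> inj_on (pos \<sigma> (r Z)) S}) \<longlonglongrightarrow> 0"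
    proof (rule tendsto_sandwich[OF _ _ tendsto_const, rotated 2])
      show "\<forall>\<^sub>F Z in sequentially. 0 \<le> P Z {\<sigma>. \<not> inj_on (pos \<sigma> (r Z)) S}"
        by (simp add: P_def)
      show "\<forall>\<^sub>F Z in sequentially. P Z {\<sigma>. \<not> inj_on (pos \<sigma> (r Z)) S} \<le>
          P Z {\<sigma>. \<not> inj_on (pos \<sigma> (r Z)) S'} + card S' * (1 / (real Z - real (card S')))"
        using eventually_gt_at_top[of "card S'"] by eventually_elim (rule bound)
    qed
    then show ?thesis by (simp add: P_def)
  qed
qed

end

theorem theorem1:
  fixes nc nv :: nat and B :: "nat \<Rightarrow> nat \<Rightarrow> nat" and j l :: nat and k :: "nat \<Rightarrow> nat"
  assumes "j \<in> {1..nv}"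
    and "\<And>Z. Z > 0 \<Longrightarrow> k Z < Z"
  shows "(\<lambda>Z. measure_pmf.prob (random_lifting nc nv B Z)
            {\<sigma>. rooted_iso (neighborhood (lifted_graph nc nv B Z \<sigma>) (2 * l) (VN j, k Z)) (VN j, k Z)
                  (tree_graph (T_tree nc nv B l j)) []})
         \<longlonglongrightarrow> 1"
proof -
  interpret protomatrix nc nv B .
  define t where "t = VN j"
  have t: "t \<in> types" using assms(1) by (auto simp: t_def types_def)
  let ?P = "positions (2 * l) t"
  let ?r = "\<lambda>Z. (t, k Z)"
  let ?prob = "\<lambda>Z. measure_pmf.prob (random_lifting nc nv B Z)"
  let ?iso = "\<lambda>Z. {\<sigma>. rooted_iso (neighborhood (lifted_graph nc nv B Z \<sigma>) (2 * l) (?r Z)) (?r Z)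
    (tree_graph (T_tree nc nv B l j)) []}"
  have "(\<lambda>Z. ?prob Z {\<sigma>. \<not> inj_on (pos \<sigma> (?r Z)) ?P}) \<longlonglongrightarrow> 0"
    using assms(2) t positions_snocD by (intro prob_not_inj_tendsto_0[where t = t and n = "2 * l"]) auto
  then have lim: "(\<lambda>Z. 1 - ?prob Z {\<sigma>. \<not> inj_on (pos \<sigma> (?r Z)) ?P}) \<longlonglongrightarrow> 1 - 0"
    by (intro tendsto_diff tendsto_const)
  have "1 - ?prob Z {\<sigma>. \<not> inj_on (pos \<sigma> (?r Z)) ?P} \<le> ?prob Z (?iso Z)" if "Z > 0" for Z
  proof -
    have "1 - ?prob Z {\<sigma>. \<not> inj_on (pos \<sigma> (?r Z)) ?P} = ?prob Z {\<sigma>. inj_on (pos \<sigma> (?r Z)) ?P}"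
      using measure_pmf.prob_compl[of "{\<sigma>. \<not> inj_on (pos \<sigma> (?r Z)) ?P}" "random_lifting nc nv B Z"]
      by (simp add: Compl_eq_Diff_UNIV[symmetric] Collect_neg_eq[symmetric])
    \<comment> \<open>The isomorphism is available only for \<open>\<sigma> \<in> lifts Z\<close>;
      cutting the event down to the support provides this at no cost in probability.\<close>
    also have "\<dots> = ?prob Z ({\<sigma>. inj_on (pos \<sigma> (?r Z)) ?P} \<inter> set_pmf (random_lifting nc nv B Z))"
      by (rule measure_Int_set_pmf[symmetric])
    also have "\<dots> \<le> ?prob Z (?iso Z)"
    proof (intro measure_pmf.finite_measure_mono subsetI)
      fix \<sigma> assume "\<sigma> \<in> {\<sigma>. inj_on (pos \<sigma> (?r Z)) ?P} \<inter> set_pmf (random_lifting nc nv B Z)"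
      then have "\<sigma> \<in> lifts Z" "inj_on (pos \<sigma> (?r Z)) ?P"
        using finite_lifts lifts_nonempty by (auto simp: random_lifting_eq)
      then show "\<sigma> \<in> ?iso Z"
        using rooted_iso_neighborhood[of \<sigma> Z "?r Z" "2 * l"] t assms(2)[OF that]
        by (simp add: T_tree_eq_cover t_def)
    qed auto
    finally show ?thesis .
  qed
  then have "\<forall>\<^sub>F Z in sequentially.
      1 - ?prob Z {\<sigma>. \<not> inj_on (pos \<sigma> (?r Z)) ?P} \<le> ?prob Z (?iso Z)"
    by (rule eventually_mono[OF eventually_gt_at_top[of 0]])
  then have "(\<lambda>Z. ?prob Z (?iso Z)) \<longlonglongrightarrow> 1"
    by (rule tendsto_sandwich[OF _ _ lim[simplified] tendsto_const]) simp
  then show ?thesis by (simp add: t_def)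
qed

end
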